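(* Let $a,b,m\in\mathbb{Z}$ with $a\ge 2$, $m>1$, $\gcd(b,m)=1$, and $b\ge -(a-2)m-2$, and let $S=S_{a,b}(m)$. Let $n$ be the smallest positive integer such that $A_n\ge m$. Then \[ \operatorname{Ap}(S)=\left\{\sum_{i=1}^{n-1} u_i s_i\ \middle|\ (u_1,\ldots,u_{n-1})\in \mathcal{R}_m(a)\right\}. \]
   Context: $\mathbb{N}=\{0,1,2,\dots\}$. Let $T_{a,b}(z)=az+b$, with $T_{a,b}^i$ its $i$-fold composition ($T_{a,b}^0$ the identity), and let $S_{a,b}(m)=\langle T_{a,b}^i(m)\mid i\ge 0\rangle$ be the submonoid of $(\mathbb{N},+)$ generated by the orbit of $m$; under the stated hypotheses it is a numerical semigroup (finite complement in $\mathbb{N}$) whose smallest positive element is $m$. Set $d=(a-1)m+b$, $A_i=(a^i-1)/(a-1)$ for $i\ge 0$ (so $A_0=0$, $A_1=1$), and $s_i=T_{a,b}^i(m)=m+dA_i$. Since $m>1$, $n\ge 2$. The Apéry set is $\operatorname{Ap}(S)=\{s\in S\mid s-m\notin S\}$. For an integer $i>1$, $R(a,i)$ is the set of $\mathbf{u}=(u_1,\ldots,u_{i-1})\in\mathbb{N}^{i-1}$ such that (a) $0\le u_j\le a$ for every $j=1,\ldots,i-1$; (b) if $u_j=a$, then $u_k=0$ for every $k<j$. Define \[ \mathcal{R}_m(a)=\left\{\mathbf{u}=(u_1,\ldots,u_{n-1})\in R(a,n)\ \middle|\ \sum_{i=1}^{n-1}u_iA_i<m\right\}. \] *)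

theory Defs
  imports Complex_Main "HOL-Library.FuncSet"
begin

definition T :: "int \<Rightarrow> int \<Rightarrow> int \<Rightarrow> int" where
  "T a b z = a * z + b"

inductive_set submonoid_gen :: "'a::comm_monoid_add set \<Rightarrow> 'a set" for G where
  zero: "0 \<in> submonoid_gen G"
| gen: "x \<in> G \<Longrightarrow> x \<in> submonoid_gen G"
| add: "x \<in> submonoid_gen G \<Longrightarrow> y \<in> submonoid_gen G \<Longrightarrow> x + y \<in> submonoid_gen G"

definition s :: "int \<Rightarrow> int \<Rightarrow> int \<Rightarrow> nat \<Rightarrow> int" where
  "s a b m i = (T a b ^^ i) m"

text \<open>
  Since \<open>b\<close> may be negative, everything is computed in the integers. Under the hypotheses of the
  theorem every orbit element is positive, so the submonoid of the integers generated by the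
  orbit is the submonoid of the natural numbers generated by it. Working in the integers also
  keeps the subtraction in the definition of the Apery set from being truncated.
\<close>

definition S :: "int \<Rightarrow> int \<Rightarrow> int \<Rightarrow> int set" where
  "S a b m = submonoid_gen (range (\<lambda>i. (T a b ^^ i) m))"

definition Ap :: "int \<Rightarrow> int set \<Rightarrow> int set" where
  "Ap m H = {x \<in> H. x - m \<notin> H}"

text \<open>The division below is exact, because \<open>a - 1\<close> divides \<open>a ^ i - 1\<close>.\<close>

definition A :: "int \<Rightarrow> nat \<Rightarrow> int" where
  "A a i = (a ^ i - 1) div (a - 1)"

text \<open>
  Tuples \<open>(u\<^sub>1, \<dots>, u\<^bsub>i-1\<^esub>)\<close> of natural numbers are extensional functions on \<open>{1..<i}\<close>.
\<close>

definition R :: "int \<Rightarrow> nat \<Rightarrow> (nat \<Rightarrow> nat) set" where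
  "R a i = {u \<in> {1..<i} \<rightarrow>\<^sub>E UNIV.
     (\<forall>j\<in>{1..<i}. int (u j) \<le> a) \<and>
     (\<forall>j\<in>{1..<i}. int (u j) = a \<longrightarrow> (\<forall>k\<in>{1..<j}. u k = 0))}"

text \<open>
  In \<open>Rm a m n\<close> the argument \<open>n\<close> is meant to be the least positive integer with \<open>m \<le> A a n\<close>.
\<close>

definition Rm :: "int \<Rightarrow> int \<Rightarrow> nat \<Rightarrow> (nat \<Rightarrow> nat) set" where
  "Rm a m n = {u \<in> R a n. (\<Sum>i\<in>{1..<n}. int (u i) * A a i) < m}"

end

theory Submission
  imports Defs
begin

text \<open>
  Put \<open>d = (a - 1) * m + b\<close>, so that \<open>s\<^sub>i = m + d * A\<^sub>i\<close> with \<open>d\<close> coprime to \<open>m\<close>, \<open>d \<ge> 1\<close> and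
  \<open>d \<ge> m - 2\<close>. A sum of \<open>c\<close> generators equals \<open>m * c + d * N\<close>, where \<open>N\<close> is the sum of the \<open>c\<close>
  corresponding coins \<open>A\<^sub>i\<close>, and its residue modulo \<open>m\<close> is determined by that of \<open>N\<close>. Each Apery
  element is the least element of \<open>S\<close> in its residue class. Replacing \<open>N\<close> by \<open>t = N mod m\<close> never
  increases the value: if \<open>N \<ge> t + m\<close>, then at most \<open>t \<le> m - 1\<close> coins are needed for \<open>t\<close>, whereas
  \<open>N\<close> costs at least one coin and \<open>d \<ge> m - 2\<close> in addition. If \<open>N = t\<close>, one needs the fewest coins
  that sum to \<open>t\<close>. For the coins \<open>A\<^sub>i\<close> the greedy algorithm is optimal, and the tuples in \<open>R a n\<close>
  are the greedy representations.
\<close>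

section \<open>The coin system\<close>

lemma A_mult:
  fixes a :: int
  assumes "a \<ge> 2"
  shows "(a - 1) * A a i = a ^ i - 1"
proof -
  have "(a - 1) dvd a ^ i - 1"
    by (metis dvd_triv_left power_diff_1_eq)
  then show ?thesis by (simp add: A_def)
qed

lemma A_0 [simp]: "A a 0 = 0"
  by (simp add: A_def)

lemma A_Suc:
  assumes "a \<ge> 2"
  shows "A a (Suc i) = a * A a i + 1"
proof -
  have "(a - 1) * A a (Suc i) = (a - 1) * (a * A a i + 1)"
    using A_mult[OF assms, of i] A_mult[OF assms, of "Suc i"] by (simp add: algebra_simps)
  then show ?thesis using assms by simp
qed

lemma A_ge:
  assumes "a \<ge> 2"
  shows "A a i \<ge> int i"
proof (induction i)
  case (Suc i)
  have "a * A a i \<ge> 1 * A a i"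
    using Suc assms by (intro mult_right_mono) auto
  then show ?case using Suc by (simp add: A_Suc[OF assms])
qed simp

lemma A_nonneg: "a \<ge> 2 \<Longrightarrow> A a i \<ge> 0"
  using A_ge[of a i] by linarith

lemma A_Suc_pos: "a \<ge> 2 \<Longrightarrow> A a (Suc i) > 0"
  using A_ge[of a "Suc i"] by linarith

section \<open>Greedy coin counts and their optimality\<close>

text \<open>
  The number of coins that the greedy algorithm uses for \<open>N\<close> with the coins \<open>A\<^sub>1, \<dots>, A\<^sub>k\<close>. The
  base case only matters at \<open>N = 0\<close>, because \<open>A\<^sub>1 = 1\<close>; the value \<open>N\<close> makes the count antitone
  in \<open>k\<close> from \<open>k = 0\<close> on.
\<close>

fun greedy :: "int \<Rightarrow> nat \<Rightarrow> int \<Rightarrow> int" where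
  "greedy a 0 N = N"
| "greedy a (Suc k) N = N div A a (Suc k) + greedy a k (N mod A a (Suc k))"

lemma greedy_0 [simp]: "greedy a k 0 = 0"
  by (induction k) auto

lemma greedy_add_mult:
  assumes "a \<ge> 2"
  shows "greedy a (Suc k) (q * A a (Suc k) + N) = q + greedy a (Suc k) N"
  using A_Suc_pos[OF assms, of k] by simp

lemma greedy_mult_le:
  assumes "a \<ge> 2"
  shows "greedy a k (a * A a k) \<le> a"
proof (cases k)
  case 0
  then show ?thesis using assms by simp
next
  case (Suc j)
  then show ?thesis using greedy_add_mult[OF assms, of j a 0] by simp
qed

text \<open>In a greedy representation of \<open>N + 1\<close>, the least coin \<open>A\<^sub>i\<close> can be traded for \<open>a\<close> coins \<open>A\<^bsub>i-1\<^esub>\<close>.\<close>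

lemma greedy_le_greedy_succ:
  assumes "a \<ge> 2" and "N \<ge> 0"
  shows "greedy a k N \<le> greedy a k (N + 1) + a - 1"
  using assms(2)
proof (induction k arbitrary: N)
  case 0
  then show ?case using assms(1) by simp
next
  case (Suc k)
  define B where "B = A a (Suc k)"
  have B: "B > 0" "B = a * A a k + 1"
    using A_Suc_pos[OF assms(1)] A_Suc[OF assms(1)] by (auto simp: B_def)
  define q r where "q = (N + 1) div B" and "r = (N + 1) mod B"
  have N: "N = q * B + (r - 1)" and N1: "N + 1 = q * B + r"
    unfolding q_def r_def by (simp_all add: algebra_simps)
  have r: "0 \<le> r" "r < B" using B(1) by (auto simp: r_def)
  have succ: "greedy a (Suc k) (N + 1) = q + greedy a k r"
    by (simp add: q_def r_def B_def)
  show ?case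
  proof (cases "r = 0")
    case True
    \<comment> \<open>No smaller coin remains in \<open>N + 1\<close>, so one coin \<open>B\<close>
      is broken up: \<open>B - 1 = a * A a k\<close>.\<close>
    have "N = (q - 1) * B + a * A a k"
      using N True B(2) by (simp add: algebra_simps)
    then have "greedy a (Suc k) N = q - 1 + greedy a (Suc k) (a * A a k)"
      using greedy_add_mult[OF assms(1), of k "q - 1"] by (simp only: B_def)
    moreover have "greedy a (Suc k) (a * A a k) = greedy a k (a * A a k)"
      using B A_nonneg[OF assms(1), of k] assms(1) by (simp add: B_def)
    ultimately show ?thesis
      using greedy_mult_le[OF assms(1), of k] succ True by simp
  next
    case False
    have "greedy a (Suc k) N = q + greedy a (Suc k) (r - 1)"
      using N greedy_add_mult[OF assms(1), of k q] by (simp only: B_def)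
    also have "greedy a (Suc k) (r - 1) = greedy a k (r - 1)"
      using r False by (simp add: B_def)
    also have "\<dots> \<le> greedy a k r + a - 1"
      using Suc.IH[of "r - 1"] r False by simp
    finally show ?thesis using succ by simp
  qed
qed

text \<open>Since \<open>A a (Suc k) = a * A a k + 1\<close>, adding this value without its own coin
  costs \<open>a\<close> coins \<open>A a k\<close> and raises the rest by 1, which saves at most
  \<open>a - 1\<close> coins.\<close>

lemma greedy_add_next_coin:
  assumes "a \<ge> 2" and "N \<ge> 0"
  shows "1 + greedy a k N \<le> greedy a k (A a (Suc k) + N)"
proof (cases k)
  case 0
  then show ?thesis by (simp add: A_Suc[OF assms(1)])
next
  case (Suc j)
  have "A a (Suc k) + N = a * A a (Suc j) + (N + 1)"
    by (simp add: A_Suc[OF assms(1)] Suc)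
  then have "greedy a k (A a (Suc k) + N) = a + greedy a k (N + 1)"
    using greedy_add_mult[OF assms(1), of j a "N + 1"] by (simp only: Suc)
  then show ?thesis
    using greedy_le_greedy_succ[OF assms, of k] by simp
qed

text \<open>The copies of the new coin are added to the remainder one at a time; with only the
  smaller coins, each raises the count by at least 1.\<close>

lemma greedy_Suc_le:
  assumes "a \<ge> 2" and "N \<ge> 0"
  shows "greedy a (Suc k) N \<le> greedy a k N"
proof -
  have step: "int q + greedy a k r \<le> greedy a k (int q * A a (Suc k) + r)" if "r \<ge> 0" for q r
  proof (induction q)
    case (Suc q)
    have "0 \<le> int q * A a (Suc k) + r"
      using that A_nonneg[OF assms(1)] by simp
    then have "1 + greedy a k (int q * A a (Suc k) + r)
        \<le> greedy a k (A a (Suc k) + (int q * A a (Suc k) + r))"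
      by (rule greedy_add_next_coin[OF assms(1)])
    then show ?case using Suc by (simp add: algebra_simps)
  qed simp
  have B: "A a (Suc k) > 0" by (rule A_Suc_pos[OF assms(1)])
  have "0 \<le> N div A a (Suc k)" using B assms(2) by (simp add: pos_imp_zdiv_nonneg_iff)
  then show ?thesis
    using step[of "N mod A a (Suc k)" "nat (N div A a (Suc k))"] B
    by (simp only: greedy.simps int_nat_eq if_True div_mult_mod_eq pos_mod_sign)
qed

lemma greedy_add_coin:
  assumes "a \<ge> 2" and "N \<ge> 0" and "i \<le> k"
  shows "greedy a k (N + A a i) \<le> greedy a k N + 1"
  using assms(2,3)
proof (induction k arbitrary: N)
  case 0
  then show ?case by simp
next
  case (Suc k)
  show ?case
  proof (cases "i = Suc k")
    case True
    then show ?thesis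
      using greedy_add_mult[OF assms(1), of k 1 N] by (simp add: add.commute)
  next
    case False
    define q r where "q = N div A a (Suc k)" and "r = N mod A a (Suc k)"
    have r: "r \<ge> 0" using A_Suc_pos[OF assms(1)] by (simp add: r_def)
    \<comment> \<open>\<open>r + A a i\<close> may reach the top coin, so the induction hypothesis
      applies only after passing to the coins up to \<open>k\<close>.\<close>
    have "N + A a i = q * A a (Suc k) + (r + A a i)"
      by (simp add: q_def r_def algebra_simps)
    then have "greedy a (Suc k) (N + A a i) = q + greedy a (Suc k) (r + A a i)"
      using greedy_add_mult[OF assms(1)] by (simp only:)
    also have "\<dots> \<le> q + greedy a k (r + A a i)"
      using greedy_Suc_le[OF assms(1), of "r + A a i" k] r A_nonneg[OF assms(1), of i] by simp
    also have "\<dots> \<le> q + greedy a k r + 1"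
      using Suc.IH[OF r] Suc.prems(2) False by simp
    finally show ?thesis by (simp add: q_def r_def)
  qed
qed

lemma sum_list_A_nonneg: "a \<ge> 2 \<Longrightarrow> sum_list (map (A a) L) \<ge> 0"
  by (intro sum_list_nonneg) (auto simp: A_nonneg)

text \<open>Optimality: building \<open>L\<close> coin by coin raises the greedy count by at most 1
  each time. Index 0 is the coin of value 0, which stands for the generator
  \<open>m\<close>.\<close>

lemma greedy_le_length:
  assumes "a \<ge> 2" and "set L \<subseteq> {..k}"
  shows "greedy a k (sum_list (map (A a) L)) \<le> int (length L)"
  using assms(2)
proof (induction L)
  case (Cons i L)
  then show ?case
    using greedy_add_coin[OF assms(1) sum_list_A_nonneg[OF assms(1), of L], of i k]
    by (simp add: add.commute)
qed simp

lemma greedy_eq: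
  assumes "N \<ge> 0" and "N < A a (Suc k)" and "k \<le> K" and "a \<ge> 2"
  shows "greedy a K N = greedy a k N"
  using assms(3)
proof (induction K rule: dec_induct)
  case (step K)
  have "A a (Suc j) \<ge> A a j" for j
    using A_Suc[OF assms(4), of j] mult_right_mono[of 1 a "A a j"] A_nonneg[OF assms(4), of j]
      assms(4) by simp
  then have "A a (Suc k) \<le> A a (Suc K)"
    using step.hyps lift_Suc_mono_le[of "A a" "Suc k" "Suc K"] by simp
  then have "N < A a (Suc K)" using assms(2) by linarith
  then have "greedy a (Suc K) N = greedy a K N" using assms(1) by simp
  then show ?case using step.IH by simp
qed simp

section \<open>Greedy representations\<close>

lemma atLeastLessThan_Suc_insert: "{1..<Suc (Suc k)} = insert (Suc k) {1..<Suc k}"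
  by auto

text \<open>The bound \<open>a * A a k\<close> is \<open>A a (Suc k) - 1\<close>, so the lower
  digits sum to a true remainder modulo the next coin and the top digit is the greedy quotient. The
  conditions of \<open>R\<close> are spelled out because extensionality is lost when the range
  shrinks.\<close>

lemma R_sum_greedy:
  assumes "a \<ge> 2"
    and "\<forall>j\<in>{1..<Suc k}. int (u j) \<le> a"
    and "\<forall>j\<in>{1..<Suc k}. int (u j) = a \<longrightarrow> (\<forall>l\<in>{1..<j}. u l = 0)"
  shows "(\<Sum>i\<in>{1..<Suc k}. int (u i) * A a i) \<le> a * A a k \<and>
    greedy a k (\<Sum>i\<in>{1..<Suc k}. int (u i) * A a i) = (\<Sum>i\<in>{1..<Suc k}. int (u i))"
  using assms(2,3)
proof (induction k)
  case (Suc k)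
  define N where "N = (\<Sum>i\<in>{1..<Suc k}. int (u i) * A a i)"
  define B where "B = A a (Suc k)"
  have B: "B = a * A a k + 1" "B > 0"
    using A_Suc[OF assms(1)] A_Suc_pos[OF assms(1)] by (auto simp: B_def)
  have IH: "N \<le> a * A a k" "greedy a k N = (\<Sum>i\<in>{1..<Suc k}. int (u i))"
    using Suc.IH Suc.prems unfolding N_def atLeastLessThan_Suc_insert by blast+
  have N0: "N \<ge> 0"
    unfolding N_def using A_nonneg[OF assms(1)] by (intro sum_nonneg) auto
  have sum: "(\<Sum>i\<in>{1..<Suc (Suc k)}. int (u i) * A a i) = int (u (Suc k)) * B + N"
    unfolding atLeastLessThan_Suc_insert by (simp add: N_def B_def)
  have count: "(\<Sum>i\<in>{1..<Suc (Suc k)}. int (u i)) = int (u (Suc k)) + greedy a k N"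
    unfolding atLeastLessThan_Suc_insert by (simp add: IH(2))
  \<comment> \<open>A top digit \<open>a\<close> forces \<open>N = 0\<close>; a smaller one leaves
    room for one more \<open>B\<close>, which exceeds \<open>N\<close>.\<close>
  have le: "int (u (Suc k)) * B + N \<le> a * B"
  proof (cases "int (u (Suc k)) = a")
    case True
    then have "\<forall>l\<in>{1..<Suc k}. u l = 0" using Suc.prems(2) by (metis atLeastLessThan_Suc_insert insertI1)
    then have "N = 0" by (simp add: N_def)
    then show ?thesis using True by simp
  next
    case False
    then have "int (u (Suc k)) + 1 \<le> a" using Suc.prems(1) by force
    then have "(int (u (Suc k)) + 1) * B \<le> a * B"
      using B(2) by (intro mult_right_mono) auto
    then show ?thesis using IH(1) B by (simp add: algebra_simps)
  qed
  have "greedy a (Suc k) (int (u (Suc k)) * B + N) = int (u (Suc k)) + greedy a (Suc k) N"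
    unfolding B_def by (rule greedy_add_mult[OF assms(1)])
  also have "greedy a (Suc k) N = greedy a k N"
    using N0 IH(1) B by (simp add: B_def)
  finally show ?case using le unfolding sum count B_def by blast
qed simp

text \<open>The digits are the greedy quotients. From \<open>N \<le> a * B\<close>, a quotient equal
  to \<open>a\<close> leaves remainder 0, and as the coins are positive all lower digits
  vanish.\<close>

lemma R_sum_exists:
  assumes "a \<ge> 2" and "0 \<le> N" and "N < A a (Suc k)"
  shows "\<exists>u\<in>R a (Suc k). (\<Sum>i\<in>{1..<Suc k}. int (u i) * A a i) = N"
  using assms(2,3)
proof (induction k arbitrary: N)
  case 0
  then show ?case by (auto simp: R_def A_Suc[OF assms(1)])
next
  case (Suc k)
  define B where "B = A a (Suc k)"
  have B: "B > 0" using A_Suc_pos[OF assms(1)] by (simp add: B_def)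
  define q r where "q = N div B" and "r = N mod B"
  have N: "N = q * B + r" by (simp add: q_def r_def)
  have r: "0 \<le> r" "r < B" using B by (auto simp: r_def)
  have q: "q \<ge> 0" using B Suc.prems by (simp add: q_def pos_imp_zdiv_nonneg_iff)
  have NB: "q * B + r \<le> a * B"
    using Suc.prems(2) N A_Suc[OF assms(1), of "Suc k"] by (simp add: B_def)
  then have "q * B \<le> a * B" using r by linarith
  then have qa: "q \<le> a" using B by simp
  obtain v where v: "v \<in> R a (Suc k)" and vr: "(\<Sum>i\<in>{1..<Suc k}. int (v i) * A a i) = r"
    using Suc.IH[of r] r by (auto simp: B_def)
  have v0: "v l = 0" if "q = a" "l \<in> {1..<Suc k}" for l
  proof -
    have "(\<Sum>i\<in>{1..<Suc k}. int (v i) * A a i) = 0" using NB that r vr by simp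
    moreover have "\<forall>i\<in>{1..<Suc k}. 0 \<le> int (v i) * A a i"
      using A_nonneg[OF assms(1)] by simp
    ultimately have "int (v l) * A a l = 0"
      using that by (subst (asm) sum_nonneg_eq_0_iff) auto
    moreover have "A a l > 0" using A_ge[OF assms(1), of l] that by simp
    ultimately show ?thesis by simp
  qed
  define u where "u = v(Suc k := nat q)"
  have "u \<in> {1..<Suc (Suc k)} \<rightarrow>\<^sub>E UNIV"
    unfolding u_def atLeastLessThan_Suc_insert using v by (intro PiE_fun_upd) (auto simp: R_def)
  moreover have "int (u j) \<le> a" if "j \<in> {1..<Suc (Suc k)}" for j
    using that v qa q by (cases "j = Suc k") (auto simp: R_def u_def)
  moreover have "u l = 0" if "j \<in> {1..<Suc (Suc k)}" "int (u j) = a" "l \<in> {1..<j}" for j l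
  proof (cases "j = Suc k")
    case True
    then show ?thesis using that v0 q by (simp add: u_def)
  next
    case False
    then have "int (v j) = a" "j \<in> {1..<Suc k}" using that by (auto simp: u_def)
    then have "v l = 0" using v that(3) unfolding R_def by blast
    then show ?thesis using that by (simp add: u_def)
  qed
  ultimately have "u \<in> R a (Suc (Suc k))" unfolding R_def by blast
  moreover have "(\<Sum>i\<in>{1..<Suc k}. int (u i) * A a i) = r"
    unfolding vr[symmetric] by (intro sum.cong) (auto simp: u_def)
  then have "(\<Sum>i\<in>{1..<Suc (Suc k)}. int (u i) * A a i) = N"
    unfolding atLeastLessThan_Suc_insert using q N by (simp add: u_def B_def)
  ultimately show ?case by blast
qed

section \<open>The semigroup\<close>

lemma s_eq:
  assumes "a \<ge> 2"
  shows "s a b m i = m + ((a - 1) * m + b) * A a i"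
proof (induction i)
  case (Suc i)
  have "s a b m (Suc i) = a * s a b m i + b" by (simp add: s_def T_def)
  then show ?case unfolding Suc A_Suc[OF assms] by (simp add: algebra_simps)
qed (simp add: s_def)

lemma s_in_S: "s a b m i \<in> S a b m"
  unfolding S_def s_def by (intro submonoid_gen.gen) auto

lemma submonoid_gen_of_nat_mult:
  fixes x :: int
  shows "x \<in> submonoid_gen G \<Longrightarrow> int j * x \<in> submonoid_gen G"
  by (induction j) (auto intro: submonoid_gen.intros simp: algebra_simps)

lemma submonoid_gen_sum:
  "(\<And>i. i \<in> I \<Longrightarrow> f i \<in> submonoid_gen G) \<Longrightarrow> sum f I \<in> submonoid_gen G"
  by (induction I rule: infinite_finite_induct) (auto intro: submonoid_gen.intros)

lemma S_sum_list:
  assumes "x \<in> S a b m"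
  shows "\<exists>L. x = sum_list (map (s a b m) L)"
  using assms unfolding S_def
proof (induction rule: submonoid_gen.induct)
  case zero
  show ?case by (rule exI[of _ "[]"]) simp
next
  case (gen x)
  then obtain i where "x = (T a b ^^ i) m" by auto
  then show ?case by (intro exI[of _ "[i]"]) (simp add: s_def)
next
  case (add x y)
  then obtain L L' where "x = sum_list (map (s a b m) L)" "y = sum_list (map (s a b m) L')" by auto
  then show ?case by (intro exI[of _ "L @ L'"]) simp
qed

lemma sum_list_s:
  assumes "a \<ge> 2"
  shows "sum_list (map (s a b m) L)
    = m * int (length L) + ((a - 1) * m + b) * sum_list (map (A a) L)"
  by (induction L) (simp_all add: s_eq[OF assms] algebra_simps)

lemma sum_s:
  assumes "a \<ge> 2"
  shows "(\<Sum>i\<in>I. int (u i) * s a b m i)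
    = m * (\<Sum>i\<in>I. int (u i)) + ((a - 1) * m + b) * (\<Sum>i\<in>I. int (u i) * A a i)"
  unfolding s_eq[OF assms] sum_distrib_left sum.distrib[symmetric]
  by (rule sum.cong) (simp_all add: algebra_simps)

lemma sum_s_in_S: "(\<Sum>i\<in>I. int (u i) * s a b m i) \<in> S a b m"
  using s_in_S unfolding S_def
  by (intro submonoid_gen_sum submonoid_gen_of_nat_mult) auto

section \<open>Least elements of the residue classes modulo \<open>m\<close>\<close>

lemma Rm_sum_least:
  assumes "a \<ge> 2" and "m > 1" and "coprime b m" and "b \<ge> - (a - 2) * m - 2"
    and "m \<le> A a (Suc k)" and "u \<in> Rm a m (Suc k)"
    and "x \<in> S a b m"
    and "m dvd x - (\<Sum>i\<in>{1..<Suc k}. int (u i) * s a b m i)"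
  shows "(\<Sum>i\<in>{1..<Suc k}. int (u i) * s a b m i) \<le> x"
proof -
  define d where "d = (a - 1) * m + b"
  define t where "t = (\<Sum>i\<in>{1..<Suc k}. int (u i) * A a i)"
  define c where "c = (\<Sum>i\<in>{1..<Suc k}. int (u i))"
  obtain L where L: "x = sum_list (map (s a b m) L)" using S_sum_list[OF assms(7)] by blast
  define N where "N = sum_list (map (A a) L)"
  have x: "x = m * int (length L) + d * N"
    using L sum_list_s[OF assms(1)] by (simp add: d_def N_def)
  have y: "(\<Sum>i\<in>{1..<Suc k}. int (u i) * s a b m i) = m * c + d * t"
    using sum_s[OF assms(1)] by (simp add: d_def c_def t_def)
  have d_ge: "d \<ge> m - 2" using assms(4) by (simp add: d_def algebra_simps)
  have cop: "coprime m d"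
    using assms(3) by (simp add: d_def coprime_iff_gcd_eq_1 gcd_add_mult gcd.commute[of b])
  have N0: "N \<ge> 0" using sum_list_A_nonneg[OF assms(1)] by (simp add: N_def)
  have u: "u \<in> R a (Suc k)" and tm: "t < m" using assms(6) by (auto simp: Rm_def t_def)
  have t0: "t \<ge> 0" unfolding t_def using A_nonneg[OF assms(1)] by (intro sum_nonneg) auto
  have ct: "c \<le> t" unfolding c_def t_def
  proof (rule sum_mono)
    fix i assume "i \<in> {1..<Suc k}"
    then have "A a i \<ge> 1" using A_ge[OF assms(1), of i] by simp
    then show "int (u i) \<le> int (u i) * A a i" by (simp add: mult_le_cancel_left1)
  qed
  have "x - (m * c + d * t) = m * (int (length L) - c) + d * (N - t)"
    unfolding x by (simp add: algebra_simps)
  then have "m dvd d * (N - t)"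
    using assms(8) unfolding y by (metis dvd_add_right_iff dvd_triv_left)
  then have "m dvd N - t" using cop by (simp add: coprime_dvd_mult_right_iff)
  then obtain j where j: "N - t = m * j" by auto
  have "m * j > m * (-1)" using j N0 tm by simp
  then have j0: "j \<ge> 0" using assms(2) by (simp only: mult_less_cancel_left) auto
  \<comment> \<open>With \<open>N = t + m * j\<close>, this is the goal divided by
    \<open>m\<close>.\<close>
  have "c \<le> int (length L) + d * j"
  proof (cases "j = 0")
    case True
    then have Nt: "N = t" using j by simp
    \<comment> \<open>\<open>L\<close> may use coins beyond \<open>k\<close>; these exceed
      \<open>t\<close>, so allowing them leaves its greedy count unchanged.\<close>
    define K where "K = Max (insert k (set L))"
    have K: "k \<le> K" "set L \<subseteq> {..K}" by (auto simp: K_def)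
    have "c = greedy a k t"
      using R_sum_greedy[OF assms(1), of k u] u by (auto simp: R_def c_def t_def)
    also have "\<dots> = greedy a K N"
      using greedy_eq[OF t0 _ K(1) assms(1)] tm assms(5) Nt by simp
    also have "\<dots> \<le> int (length L)"
      using greedy_le_length[OF assms(1) K(2)] by (simp add: N_def)
    finally show ?thesis using True by simp
  next
    case False
    then have j1: "j \<ge> 1" using j0 by simp
    then have "N > 0" using j t0 assms(2) by (smt (verit) mult_pos_pos)
    then have "L \<noteq> []" by (auto simp: N_def)
    then have "int (length L) \<ge> 1" by (cases L) auto
    \<comment> \<open>The chain is \<open>c \<le> t \<le> m - 1 \<le> 1 + d \<le> int (length L) + d
      * j\<close>.\<close>
    moreover have "d * j \<ge> d * 1"
      using d_ge assms(2) j1 by (intro mult_left_mono) auto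
    ultimately show ?thesis using ct tm d_ge by simp
  qed
  then have "m * c \<le> m * (int (length L) + d * j)"
    using assms(2) by (intro mult_left_mono) auto
  moreover have "d * N = d * t + d * (m * j)" unfolding j[symmetric] by (simp add: algebra_simps)
  ultimately show ?thesis unfolding y x by (simp add: algebra_simps)
qed

theorem theorem4p2:
  fixes a b m :: int and n :: nat
  assumes "a \<ge> 2" and "m > 1" and "gcd b m = 1" and "b \<ge> - (a - 2) * m - 2"
    and "n = (LEAST k. 0 < k \<and> A a k \<ge> m)"
  shows "Ap m (S a b m) = {(\<Sum>i\<in>{1..<n}. int (u i) * s a b m i) | u. u \<in> Rm a m n}"
proof -
  have "0 < nat m \<and> A a (nat m) \<ge> m"
    using A_ge[OF assms(1), of "nat m"] assms(2) by simp
  then have n: "0 < n \<and> A a n \<ge> m" unfolding assms(5) by (rule LeastI)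
  then obtain k where k: "n = Suc k" by (cases n) auto
  have cop: "coprime b m" using assms(3) by (simp add: coprime_iff_gcd_eq_1)
  have Ak: "m \<le> A a (Suc k)" using n k by simp
  note least = Rm_sum_least[OF assms(1,2) cop assms(4) Ak]
  show ?thesis
  proof (intro equalityI subsetI)
    fix x assume "x \<in> Ap m (S a b m)"
    then have x: "x \<in> S a b m" "x - m \<notin> S a b m" by (auto simp: Ap_def)
    obtain L where L: "x = sum_list (map (s a b m) L)" using S_sum_list[OF x(1)] by blast
    define N where "N = sum_list (map (A a) L)"
    \<comment> \<open>The choice of \<open>n\<close> ensures that every residue modulo
      \<open>m\<close> has a greedy representation with the coins below index
      \<open>n\<close>.\<close>
    have "0 \<le> N mod m" "N mod m < A a (Suc k)"
      using assms(2) Ak pos_mod_sign[of m N] pos_mod_bound[of m N] by linarith+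
    from R_sum_exists[OF assms(1) this] obtain u where u: "u \<in> R a (Suc k)"
      and uN: "(\<Sum>i\<in>{1..<Suc k}. int (u i) * A a i) = N mod m" by blast
    have uR: "u \<in> Rm a m (Suc k)" using u uN assms(2) by (simp add: Rm_def)
    define y where "y = (\<Sum>i\<in>{1..<Suc k}. int (u i) * s a b m i)"
    have "x - y = m * (int (length L) - (\<Sum>i\<in>{1..<Suc k}. int (u i)))
        + ((a - 1) * m + b) * (N - N mod m)"
      unfolding L y_def sum_list_s[OF assms(1)] sum_s[OF assms(1)] uN N_def
      by (simp add: algebra_simps)
    then have dvd: "m dvd x - y" by (simp add: minus_mod_eq_mult_div)
    then obtain j where j: "x - y = m * j" by auto
    have yx: "y \<le> x" using least[OF uR x(1)] dvd by (simp add: y_def)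
    have "x = y"
    proof (rule ccontr)
      assume "x \<noteq> y"
      then have "m * j > 0" using yx j by simp
      then have j1: "j \<ge> 1" using assms(2) by (simp add: zero_less_mult_iff)
      have "m \<in> S a b m" using s_in_S[of a b m 0] by (simp add: s_def)
      \<comment> \<open>If \<open>x\<close> exceeded \<open>y\<close>, adding one copy of
        \<open>m\<close> fewer to \<open>y\<close> would put \<open>x - m\<close> in the
        semigroup.\<close>
      then have "y + int (nat (j - 1)) * m \<in> S a b m"
        using sum_s_in_S[of u a b m "{1..<Suc k}"] unfolding S_def y_def
        by (intro submonoid_gen.add submonoid_gen_of_nat_mult)
      moreover have "y + int (nat (j - 1)) * m = x - m"
        using j j1 by (simp add: algebra_simps)
      ultimately show False using x(2) by simp
    qed
    then show "x \<in> {(\<Sum>i\<in>{1..<n}. int (u i) * s a b m i) | u. u \<in> Rm a m n}"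
      using uR k by (auto simp: y_def)
  next
    fix x assume "x \<in> {(\<Sum>i\<in>{1..<n}. int (u i) * s a b m i) | u. u \<in> Rm a m n}"
    then obtain u where u: "u \<in> Rm a m (Suc k)"
      and x: "x = (\<Sum>i\<in>{1..<Suc k}. int (u i) * s a b m i)" using k by auto
    \<comment> \<open>\<open>x - m\<close> is a smaller member of the residue class of which
      \<open>x\<close> is least in \<open>S a b m\<close>.\<close>
    have "x - m \<notin> S a b m" using least[OF u, of "x - m"] x assms(2) by auto
    then show "x \<in> Ap m (S a b m)" unfolding x Ap_def using sum_s_in_S by blast
  qed
qed

end
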